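(* Let $d\ge 2$, let $I\subset\mathbb{Z}^d$ with $|I|=s\ge 1$ (finite), let $\Lambda(\boldsymbol{z},M,I)$ be a reconstructing single rank-1 lattice for $I$, and set $$\tilde M:=\max\{\boldsymbol{k}\cdot\boldsymbol{z}:\boldsymbol{k}\in I\}-\min\{\boldsymbol{k}\cdot\boldsymbol{z}:\boldsymbol{k}\in I\}+1.$$ Then there exist primes $\tilde P_0,\ldots,\tilde P_{L-1}$, $L\le\log_2 s+1$, with $$\sum_{\ell=0}^{L-1}\tilde P_\ell\le\begin{cases}2 & \text{for } s=1,\\ 8\,s\,(\log_2\tilde M)\,\ln(2\log_2\tilde M) & \text{for } s\ge 2,\end{cases}$$ and a function $\nu:I\to[L]$ mapping each frequency to the lattice used to reconstruct the corresponding Fourier coefficient, such that for every $f\in\Pi_I$, $f(\boldsymbol{x})=\sum_{\boldsymbol{k}\in I}\widehat{f_{\boldsymbol{k}}}\,e^{2\pi i\boldsymbol{k}\cdot\boldsymbol{x}}$, and every $\boldsymbol{k}\in I$, the formula $$\widehat{f_{\boldsymbol{k}}}=\frac{1}{\tilde P_{\nu(\boldsymbol{k})}}\sum_{j=0}^{\tilde P_{\nu(\boldsymbol{k})}-1} f_{\nu(\boldsymbol{k})-1}\!\left(\frac{(j\boldsymbol{z})\bmod \tilde P_{\nu(\boldsymbol{k})}}{\tilde P_{\nu(\boldsymbol{k})}}\right)e^{-2\pi i j\,\boldsymbol{k}\cdot\boldsymbol{z}/\tilde P_{\nu(\boldsymbol{k})}}$$ with $$f_{\nu(\boldsymbol{k})-1}(\boldsymbol{x}):=f(\boldsymbol{x})-\sum_{\boldsymbol{h}\in\{\boldsymbol{l}\in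 I:\,\nu(\boldsymbol{l})<\nu(\boldsymbol{k})\}}\widehat{f_{\boldsymbol{h}}}\,e^{2\pi i\boldsymbol{h}\cdot\boldsymbol{x}}$$ holds; i.e., each multivariate trigonometric polynomial with frequencies in $I$ can be uniquely reconstructed using samples along the rank-1 lattices $\Lambda(\boldsymbol{z},\tilde P_0),\ldots,\Lambda(\boldsymbol{z},\tilde P_{L-1})$.
   Context: For $N\in\mathbb{N}$, $[N]:=\{0,\ldots,N-1\}$. For a finite $I\subset\mathbb{Z}^d$, $\Pi_I:=\mathrm{span}\{e^{2\pi i\boldsymbol{k}\cdot\circ}:\boldsymbol{k}\in I\}$. For $\boldsymbol{z}\in\mathbb{Z}^d$ and $M\in\mathbb{N}$, the rank-1 lattice with generating vector $\boldsymbol{z}$ and size $M$ is $$\Lambda(\boldsymbol{z},M):=\left\{\tfrac{(j\boldsymbol{z})\bmod M}{M}: j=0,\ldots,M-1\right\}\subset[0,1)^d$$ (mod taken componentwise). It is called a reconstructing single rank-1 lattice for $I$, written $\Lambda(\boldsymbol{z},M,I)$, if the map $I\to[M]$, $\boldsymbol{k}\mapsto\boldsymbol{k}\cdot\boldsymbol{z}\bmod M$, is injective. *)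

theory Defs
  imports "HOL-Analysis.Analysis" "HOL-Computational_Algebra.Primes"
begin

text \<open>Frequencies are vectors in \<open>int ^ 'd\<close>, where the dimension is \<open>CARD('d)\<close>.\<close>

definition freq_dot :: "int ^ 'd \<Rightarrow> int ^ 'd \<Rightarrow> int"
  where "freq_dot k z = (\<Sum>i\<in>UNIV. k $ i * z $ i)"

definition trig_monomial :: "int ^ 'd \<Rightarrow> real ^ 'd \<Rightarrow> complex"
  where "trig_monomial k x =
    exp (2 * of_real pi * \<i> * of_real ((\<chi> i. real_of_int (k $ i)) \<bullet> x))"

text \<open>The complex span of finitely many trigonometric monomials. (The library's \<open>span\<close> is the
  real one.)\<close>

definition trig_polys :: "(int ^ 'd) set \<Rightarrow> (real ^ 'd \<Rightarrow> complex) set"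
  where "trig_polys I = {f. \<exists>c. f = (\<lambda>x. \<Sum>k\<in>I. c k * trig_monomial k x)}"

definition lattice_point :: "int ^ 'd \<Rightarrow> nat \<Rightarrow> nat \<Rightarrow> real ^ 'd"
  where "lattice_point z M j = (\<chi> i. real_of_int ((int j * z $ i) mod int M) / real M)"

definition rank1_lattice :: "int ^ 'd \<Rightarrow> nat \<Rightarrow> (real ^ 'd) set"
  where "rank1_lattice z M = lattice_point z M ` {..<M}"

text \<open>The condition \<open>M > 0\<close> is explicit because \<open>a mod 0 = a\<close>.\<close>

definition reconstructing_lattice :: "int ^ 'd \<Rightarrow> nat \<Rightarrow> (int ^ 'd) set \<Rightarrow> bool"
  where "reconstructing_lattice z M I \<longleftrightarrow>
    M > 0 \<and> inj_on (\<lambda>k. freq_dot k z mod int M) I"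

text \<open>The function \<open>f\<^bsub>l-1\<^esub>\<close>: \<open>f\<close> with the contributions of all frequencies assigned
  to lattices with index less than \<open>l\<close> removed.\<close>

definition residual ::
  "(int ^ 'd) set \<Rightarrow> (int ^ 'd \<Rightarrow> nat) \<Rightarrow> (int ^ 'd \<Rightarrow> complex) \<Rightarrow>
   (real ^ 'd \<Rightarrow> complex) \<Rightarrow> nat \<Rightarrow> real ^ 'd \<Rightarrow> complex"
  where "residual I \<nu> c f l x = f x - (\<Sum>h\<in>{h\<in>I. \<nu> h < l}. c h * trig_monomial h x)"

end

theory Submission
  imports Defs
begin

text \<open>
  On a rank-1 lattice with generating vector \<open>z\<close> and \<open>P\<close> points, the monomial of
  frequency \<open>k\<close> takes the values of the one-dimensional character with frequency
  \<open>freq_dot k z\<close> modulo \<open>P\<close>. The problem is therefore one about the finite set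
  \<open>A\<close> of integers \<open>freq_dot k z\<close>, which are pairwise distinct because they are
  distinct modulo the size of a reconstructing lattice. A lattice of size \<open>P\<close> recovers the
  coefficients whose integers collide with no other modulo \<open>P\<close>. Once recovered, these
  terms can be subtracted, and the next lattice has to deal only with the integers that did
  collide.

  If a prime can be found that leaves at most half of the current set in collisions, about
  \<open>log 2 s\<close> rounds are enough, and the sizes of the primes add up geometrically. Such a
  prime comes from a weighted pigeonhole argument (\<open>exists_halving_prime\<close>). Give the prime
  \<open>p\<close> the weight \<open>ln p\<close>. A nonzero difference \<open>d\<close> has prime divisors of total
  weight at most \<open>ln \<bar>d\<bar>\<close>, so the total weight of all collisions among \<open>t\<close>
  integers with differences at most \<open>R\<close> is at most \<open>t * (t - 1) * ln R\<close>. If all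
  primes up to \<open>N\<close> failed, this weight would be at least \<open>t / 2\<close> times
  Chebyshev's function at \<open>N\<close>. Hence it suffices that Chebyshev's function at \<open>N\<close> is
  at least \<open>2 * t * ln R\<close>, and a linear lower bound for it allows \<open>N\<close> proportional to
  \<open>t * ln R\<close>. This is within the claimed size as soon as \<open>ln (2 * log 2 R)\<close> is
  moderately large, here for \<open>R \<ge> 256\<close>; for smaller ranges one explicit prime larger
  than all differences separates everything at once (\<open>exists_prime_single_lattice\<close>).

  The linear lower bound (\<open>chebyshev_theta_ge_fraction\<close>) rests on the inequality
  \<open>2 ^ n \<le> Lcm {1..Suc n}\<close>, a consequence of the divisibilities in Leibniz's harmonic
  triangle, because the least common multiple exceeds the product of the primes up to
  \<open>Suc n\<close> only by powers of small primes.
\<close>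

section \<open>A Chebyshev bound from the Leibniz triangle\<close>

text \<open>What the choice of primes requires is the linear lower bound
  \<open>chebyshev_theta N \<ge> 4 / 25 * N\<close> for \<open>N \<ge> 144\<close>: the factor
  \<open>ln (2 * log 2 M)\<close> in the main bound, which is large once \<open>M\<close> is, leaves room
  for a constant far below the true one.\<close>

definition chebyshev_theta :: "nat \<Rightarrow> real"
  where "chebyshev_theta N = (\<Sum>p | prime p \<and> p \<le> N. ln (real p))"

text \<open>For positive \<open>a\<close> the hypothesis says \<open>1 / c = 1 / a + 1 / b\<close>. Multiplying by \<open>m = lcm b c\<close>
  shows that \<open>m / a\<close> is the difference of the integers \<open>m / c\<close> and \<open>m / b\<close>.\<close>

lemma dvd_lcm_of_harmonic_difference:
  fixes a b c :: nat
  assumes "c * (a + b) = a * b" and "b > 0"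
  shows "a dvd lcm b c"
proof -
  obtain u v where u: "lcm b c = b * u" and v: "lcm b c = c * v"
    by (meson dvdE dvd_lcm1 dvd_lcm2)
  have "b * (lcm b c + a * u) = (a + b) * lcm b c"
    using u by (simp add: algebra_simps)
  also have "\<dots> = c * (a + b) * v"
    by (simp add: v)
  also have "\<dots> = b * (a * v)"
    by (simp add: assms(1))
  finally have "lcm b c + a * u = a * v"
    using assms(2) by simp
  then show ?thesis
    by (metis dvd_add_left_iff dvd_triv_left)
qed

text \<open>The reciprocals of the numbers \<open>Suc n * (n choose k)\<close> form Leibniz's harmonic
  triangle, in which every entry is the sum of the two below it. Subtracting
  the left neighbour from the entry of the row above that covers both yields each further entry of a
  row, so the divisibility passes along the row from its first entry \<open>Suc n\<close>.\<close>

lemma Suc_times_binomial_dvd_Lcm: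
  assumes "k \<le> n"
  shows "Suc n * (n choose k) dvd Lcm {1..Suc n}"
  using assms
proof (induction k arbitrary: n)
  case 0
  then show ?case by (simp add: dvd_Lcm)
next
  case (Suc k)
  then obtain m where n: "n = Suc m" and km: "k \<le> m"
    by (cases n) auto
  let ?T = "\<lambda>i j. Suc i * (i choose j)"
  have 1: "?T m k = Suc k * (Suc m choose Suc k)"
    by (rule Suc_times_binomial[symmetric])
  have 2: "?T (Suc m) k = Suc k * (Suc (Suc m) choose Suc k)"
    by (rule Suc_times_binomial[symmetric])
  have "?T m k * (?T (Suc m) (Suc k) + ?T (Suc m) k)
      = ?T m k * (Suc (Suc m) * (Suc (Suc m) choose Suc k))"
    by (simp add: algebra_simps)
  also have "\<dots> = ?T (Suc m) (Suc k) * ?T (Suc m) k"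
    unfolding 1 2 by (simp only: mult_ac)
  finally have "?T (Suc m) (Suc k) dvd lcm (?T (Suc m) k) (?T m k)"
    by (rule dvd_lcm_of_harmonic_difference) (use km in simp)
  moreover have "?T (Suc m) k dvd Lcm {1..Suc (Suc m)}"
    by (rule Suc.IH) (use km in simp)
  moreover have "?T m k dvd Lcm {1..Suc (Suc m)}"
    by (rule dvd_trans[OF Suc.IH[OF km]], rule Lcm_subset) auto
  ultimately show ?case
    unfolding n using dvd_trans lcm_least by blast
qed

lemma two_power_le_Lcm: "2 ^ n \<le> Lcm {1..Suc n}"
proof -
  have pos: "Lcm {1..Suc n} > 0"
    by (intro gr0I) (simp add: Lcm_0_iff del: One_nat_def)
  have "Suc n * 2 ^ n = (\<Sum>k\<le>n. Suc n * (n choose k))"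
    by (simp add: choose_row_sum flip: sum_distrib_left del: mult_Suc)
  also have "\<dots> \<le> (\<Sum>k\<le>n. Lcm {1..Suc n})"
    by (intro sum_mono dvd_imp_le[OF Suc_times_binomial_dvd_Lcm pos]) simp
  also have "\<dots> = Suc n * Lcm {1..Suc n}"
    by simp
  finally show ?thesis
    by (simp only: Suc_mult_le_cancel1)
qed

lemma prime_power_dvd_Lcm:
  fixes p :: nat
  assumes "finite A" and "prime p" and "p ^ e dvd Lcm A" and "e > 0" and "0 \<notin> A"
  shows "\<exists>a\<in>A. p ^ e dvd a"
  using assms
proof (induction A)
  case empty
  then show ?case by auto
next
  case (insert a A)
  have nz: "a \<noteq> 0" "Lcm A \<noteq> 0"
    using insert by (auto simp: Lcm_0_iff)
  have unit: "\<not> is_unit p"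
    using insert.prems(1) by auto
  have "e \<le> multiplicity p (lcm a (Lcm A))"
    using insert.prems nz unit by (intro multiplicity_geI) auto
  also have "\<dots> = max (multiplicity p a) (multiplicity p (Lcm A))"
    using insert.prems nz by (intro multiplicity_lcm) auto
  finally consider "e \<le> multiplicity p a" | "e \<le> multiplicity p (Lcm A)"
    by linarith
  then show ?case
  proof cases
    case 2
    then show ?thesis
      using insert.IH insert.prems multiplicity_dvd' by auto
  qed (auto intro: multiplicity_dvd')
qed

text \<open>Every prime power dividing the least common multiple divides a number up to \<open>N\<close>,
  hence is itself at most \<open>N\<close>. For a prime above \<open>sqrt N\<close> this leaves only the
  exponent 1, so the excess over the primorial comes from the few primes below.\<close>

lemma Lcm_le_primorial:
  fixes N :: nat
  assumes "N > 0"
  shows "Lcm {1..N} \<le> (\<Prod>p | prime p \<and> p \<le> N. p) * N ^ card {p. prime p \<and> p * p \<le> N}"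
proof -
  let ?S = "{p. prime p \<and> p \<le> N}"
  let ?e = "\<lambda>p. multiplicity p (Lcm {1..N})"
  have nz: "Lcm {1..N} \<noteq> 0"
    by (simp add: Lcm_0_iff del: One_nat_def)
  have fin: "finite ?S" by simp
  have le: "p ^ ?e p \<le> N" if p: "prime p" for p
  proof (cases "?e p = 0")
    case False
    then obtain m where "m \<in> {1..N}" "p ^ ?e p dvd m"
      using prime_power_dvd_Lcm[OF _ p multiplicity_dvd, of "{1..N}"] by auto
    then show ?thesis
      using dvd_imp_le[of "p ^ ?e p" m] by auto
  qed (use assms in simp)
  have small: "p ^ ?e p \<le> p * (if p * p \<le> N then N else 1)" if "prime p" for p
  proof (cases "p * p \<le> N")
    case True
    moreover have "N \<le> p * N"
      using prime_gt_0_nat[OF that] by simp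
    ultimately show ?thesis
      using le[OF that] by (simp add: le_trans)
  next
    case False
    then have "p ^ ?e p < p ^ 2"
      using le[OF that] by (simp add: power2_eq_square)
    then have "?e p \<le> 1"
      using power_less_imp_less_exp[OF prime_gt_1_nat[OF that], of "?e p" 2] by linarith
    then have "p ^ ?e p \<le> p ^ 1"
      using prime_gt_0_nat[OF that] by (intro power_increasing) auto
    then show ?thesis using False by simp
  qed
  have "prime_factors (Lcm {1..N}) \<subseteq> ?S"
  proof
    fix p assume p: "p \<in> prime_factors (Lcm {1..N})"
    then have "?e p \<ge> 1" "prime p"
      by (auto simp: prime_factors_multiplicity)
    then have "p ^ 1 \<le> p ^ ?e p" 
      using prime_gt_0_nat[OF \<open>prime p\<close>] by (intro power_increasing) auto
    then show "p \<in> ?S"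
      using le[OF \<open>prime p\<close>] \<open>prime p\<close> by simp
  qed
  then have "(\<Prod>p\<in>prime_factors (Lcm {1..N}). p ^ ?e p) = (\<Prod>p\<in>?S. p ^ ?e p)"
    by (intro prod.mono_neutral_left fin) (auto simp: prime_factors_multiplicity)
  then have "Lcm {1..N} = (\<Prod>p\<in>?S. p ^ ?e p)"
    using prime_factorization_nat[of "Lcm {1..N}"] nz by (simp del: One_nat_def)
  also have "\<dots> \<le> (\<Prod>p\<in>?S. p * (if p * p \<le> N then N else 1))"
    by (intro prod_mono) (use small in auto)
  also have "\<dots> = (\<Prod>p\<in>?S. p) * (\<Prod>p\<in>?S. if p * p \<le> N then N else 1)"
    by (rule prod.distrib)
  also have "(\<Prod>p\<in>?S. if p * p \<le> N then N else 1) = (\<Prod>p\<in>{p\<in>?S. p * p \<le> N}. N)"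
    by (rule prod.inter_filter[OF fin, symmetric])
  also have "{p\<in>?S. p * p \<le> N} = {p. prime p \<and> p * p \<le> N}"
    by (auto intro: le_trans[OF le_square])
  finally show ?thesis by simp
qed

lemma chebyshev_theta_lower:
  fixes N :: nat
  assumes "N > 0"
  shows "(real N - 1) * ln 2 - sqrt (real N) * ln (real N) \<le> chebyshev_theta N"
proof -
  let ?S = "{p. prime p \<and> p \<le> N}" and ?c = "card {p. prime p \<and> p * p \<le> N}"
  have "2 ^ (N - 1) \<le> (\<Prod>p\<in>?S. p) * N ^ ?c"
    using two_power_le_Lcm[of "N - 1"] Lcm_le_primorial[OF assms] assms by simp
  then have "real (2 ^ (N - 1)) \<le> real ((\<Prod>p\<in>?S. p) * N ^ ?c)"
    by (simp only: of_nat_le_iff)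
  then have "(2::real) ^ (N - 1) \<le> real ((\<Prod>p\<in>?S. p) * N ^ ?c)"
    by simp
  also have "\<dots> = (\<Prod>p\<in>?S. real p) * real N ^ ?c"
    by simp
  finally have "ln ((2::real) ^ (N - 1)) \<le> ln ((\<Prod>p\<in>?S. real p) * real N ^ ?c)"
    by (subst ln_le_cancel_iff) (use assms in \<open>auto intro!: mult_pos_pos prod_pos simp: prime_gt_0_nat\<close>)
  also have "\<dots> = ln (\<Prod>p\<in>?S. real p) + ln (real N ^ ?c)"
    by (rule ln_mult_pos) (use assms in \<open>auto intro!: prod_pos simp: prime_gt_0_nat\<close>)
  also have "ln (\<Prod>p\<in>?S. real p) = chebyshev_theta N"
    unfolding chebyshev_theta_def by (rule ln_prod) (auto simp: prime_gt_0_nat)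
  also have "ln (real N ^ ?c) = real ?c * ln (real N)"
    using assms by (simp add: ln_realpow)
  finally have 1: "(real N - 1) * ln 2 \<le> chebyshev_theta N + real ?c * ln (real N)"
    using assms by (simp add: ln_realpow of_nat_diff)
  have "{p. prime p \<and> p * p \<le> N} \<subseteq> {1..nat \<lfloor>sqrt (real N)\<rfloor>}"
  proof clarify
    fix p assume "prime p" "p * p \<le> N"
    then have "(real p)\<^sup>2 \<le> real N"
      by (simp add: power2_eq_square flip: of_nat_mult)
    then have "real p \<le> sqrt (real N)"
      by (rule real_le_rsqrt)
    then show "p \<in> {1..nat \<lfloor>sqrt (real N)\<rfloor>}"
      using prime_gt_0_nat[OF \<open>prime p\<close>] by (simp add: le_nat_floor Suc_le_eq)
  qed
  then have "?c \<le> nat \<lfloor>sqrt (real N)\<rfloor>"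
    using card_mono[of "{1..nat \<lfloor>sqrt (real N)\<rfloor>}"] by simp
  then have "real ?c \<le> real (nat \<lfloor>sqrt (real N)\<rfloor>)"
    by (simp only: of_nat_le_iff)
  also have "\<dots> \<le> sqrt (real N)"
    by (rule of_nat_floor) simp
  finally have "real ?c \<le> sqrt (real N)" .
  then have "real ?c * ln (real N) \<le> sqrt (real N) * ln (real N)"
    using assms by (intro mult_right_mono) auto
  then show ?thesis using 1 by linarith
qed

text \<open>The error term \<open>sqrt N * ln N\<close> is at most \<open>31 / 72 * N\<close> from
  \<open>N = 144\<close> on, and \<open>2 / 3 - 31 / 72 = 17 / 72\<close> exceeds \<open>4 / 25\<close> by
  enough to absorb the missing 1 in the main term \<open>(N - 1) * ln 2\<close>.\<close>

lemma chebyshev_theta_ge_fraction: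
  assumes "N \<ge> 144"
  shows "chebyshev_theta N \<ge> 4 / 25 * real N"
proof -
  define y where "y = sqrt (real N)"
  have y: "y \<ge> 12" and N: "real N = y * y"
    unfolding y_def using assms by (auto intro: real_le_rsqrt)
  have ln2: "ln 2 \<ge> (2/3 :: real)" "ln 2 \<le> (25/36 :: real)"
    using ln2_ge_two_thirds ln2_le_25_over_36 by auto
  \<comment> \<open>The tangent of the logarithm at 8, a point close to 12 whose logarithm is \<open>3 * ln 2\<close>.\<close>
  have "ln (y / 8) \<le> y / 8 - 1"
    using y by (intro ln_le_minus_one) auto
  moreover have "ln (y / 8) = ln y - 3 * ln 2"
    using y ln_realpow[of 2 3] by (simp add: ln_div)
  ultimately have "ln y \<le> y / 8 + 13 / 12"
    using ln2 by linarith
  then have "ln (real N) \<le> y / 4 + 13 / 6"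
    using y by (simp add: N ln_mult_pos)
  then have "y * ln (real N) \<le> y * (y / 4 + 13 / 6)"
    using y by (intro mult_left_mono) auto
  also have "\<dots> = real N / 4 + 13 / 6 * y"
    by (simp add: N algebra_simps)
  also have "\<dots> \<le> real N / 4 + 13 / 6 * (real N / 12)"
    using mult_right_mono[of 12 y y] y by (simp add: N)
  finally have "y * ln (real N) \<le> 31 / 72 * real N"
    by simp
  moreover have "(real N - 1) * (2 / 3) \<le> (real N - 1) * ln 2"
    using ln2 assms by (intro mult_left_mono) auto
  ultimately have "(real N - 1) * (2 / 3) - 31 / 72 * real N \<le> chebyshev_theta N"
    using chebyshev_theta_lower[of N] assms unfolding y_def by linarith
  moreover have "real N \<ge> 144"
    using assms by simp
  ultimately show ?thesis
    by argo
qed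

section \<open>Primes that separate half of a set\<close>

lemma sum_ln_prime_divisors_le:
  fixes m :: nat
  assumes "finite S" and "\<And>p. p \<in> S \<Longrightarrow> prime p" and "\<And>p. p \<in> S \<Longrightarrow> p dvd m" and "m > 0"
  shows "(\<Sum>p\<in>S. ln (real p)) \<le> ln (real m)"
proof -
  have "(\<Prod>p\<in>S. p) dvd m"
    using assms(1-3)
  proof (induction S)
    case (insert p S)
    have "coprime p (\<Prod>q\<in>S. q)"
    proof (rule prod_coprime_right)
      fix q assume "q \<in> S"
      then show "coprime p q"
        using insert by (intro primes_coprime) auto
    qed
    then have "p * (\<Prod>q\<in>S. q) dvd m"
      using insert by (intro divides_mult) auto
    then show ?case
      using insert by simp
  qed simp
  then have "(\<Prod>p\<in>S. p) \<le> m"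
    using assms(4) by (rule dvd_imp_le)
  then have "(\<Prod>p\<in>S. real p) \<le> real m"
    by (simp flip: of_nat_prod)
  moreover have "(\<Prod>p\<in>S. real p) > 0"
    using assms(2) by (intro prod_pos) (simp add: prime_gt_0_nat)
  moreover have "ln (\<Prod>p\<in>S. real p) = (\<Sum>p\<in>S. ln (real p))"
    using assms by (intro ln_prod) (auto simp: prime_gt_0_nat)
  ultimately show ?thesis
    by (metis ln_mono)
qed

definition colliding :: "int set \<Rightarrow> nat \<Rightarrow> int set"
  where "colliding A p = {a\<in>A. \<exists>b\<in>A. b \<noteq> a \<and> int p dvd a - b}"

text \<open>Count each collision with weight \<open>ln p\<close>. For a fixed pair \<open>a \<noteq> b\<close> the
  primes dividing \<open>a - b\<close> have total weight at most \<open>ln \<bar>a - b\<bar>\<close>, so every one of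
  the \<open>card A * (card A - 1)\<close> ordered pairs contributes at most \<open>ln R\<close>. Counting
  the primes without weights would cost a further factor logarithmic in \<open>card A\<close>.\<close>

lemma sum_ln_card_colliding_le:
  fixes R :: real
  assumes "finite A" and "\<And>a b. a \<in> A \<Longrightarrow> b \<in> A \<Longrightarrow> real_of_int \<bar>a - b\<bar> \<le> R"
  shows "(\<Sum>p | prime p \<and> p \<le> N. ln (real p) * real (card (colliding A p)))
    \<le> real (card A) * real (card A - 1) * ln R"
proof -
  let ?S = "{p. prime p \<and> p \<le> N}"
  let ?hit = "\<lambda>a b p. of_bool (int p dvd a - b) :: real"
  have "real (card (colliding A p)) \<le> (\<Sum>a\<in>A. \<Sum>b\<in>A - {a}. ?hit a b p)" for p
  proof -
    have "real (card (colliding A p)) = (\<Sum>a\<in>A. of_bool (a \<in> colliding A p))"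
      using assms(1) by (simp add: colliding_def Collect_conj_eq flip: of_nat_sum)
    also have "\<dots> \<le> (\<Sum>a\<in>A. \<Sum>b\<in>A - {a}. ?hit a b p)"
    proof (rule sum_mono)
      fix a assume "a \<in> A"
      show "of_bool (a \<in> colliding A p) \<le> (\<Sum>b\<in>A - {a}. ?hit a b p)"
      proof (cases "a \<in> colliding A p")
        case True
        then obtain b where "b \<in> A - {a}" "int p dvd a - b"
          by (auto simp: colliding_def)
        then show ?thesis
          using True assms(1) member_le_sum[of b "A - {a}" "\<lambda>b. ?hit a b p"] by simp
      qed (simp add: sum_nonneg)
    qed
    finally show ?thesis .
  qed
  then have "(\<Sum>p\<in>?S. ln (real p) * real (card (colliding A p)))
      \<le> (\<Sum>p\<in>?S. ln (real p) * (\<Sum>a\<in>A. \<Sum>b\<in>A - {a}. ?hit a b p))"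
    by (intro sum_mono mult_left_mono) (auto simp: Suc_le_eq prime_gt_0_nat)
  also have "\<dots> = (\<Sum>p\<in>?S. \<Sum>a\<in>A. \<Sum>b\<in>A - {a}. ln (real p) * ?hit a b p)"
    by (simp add: sum_distrib_left)
  also have "\<dots> = (\<Sum>a\<in>A. \<Sum>b\<in>A - {a}. \<Sum>p\<in>?S. ln (real p) * ?hit a b p)"
    by (subst sum.swap, intro sum.cong refl, rule sum.swap)
  also have "\<dots> \<le> (\<Sum>a\<in>A. \<Sum>b\<in>A - {a}. ln R)"
  proof (intro sum_mono)
    fix a b assume "a \<in> A" "b \<in> A - {a}"
    then have pos: "nat \<bar>a - b\<bar> > 0" and R: "real_of_int \<bar>a - b\<bar> \<le> R"
      using assms(2) by auto
    have "(\<Sum>p\<in>?S. ln (real p) * ?hit a b p) = (\<Sum>p\<in>{p\<in>?S. int p dvd a - b}. ln (real p))"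
      by (intro sum.mono_neutral_cong_right) auto
    also have "\<dots> \<le> ln (real (nat \<bar>a - b\<bar>))"
      by (rule sum_ln_prime_divisors_le) (use pos in \<open>auto simp: dvd_nat_abs_iff\<close>)
    also have "\<dots> \<le> ln R"
      using pos R by (subst ln_le_cancel_iff) auto
    finally show "(\<Sum>p\<in>?S. ln (real p) * ?hit a b p) \<le> ln R" .
  qed
  also have "\<dots> = real (card A) * real (card A - 1) * ln R"
    using assms(1) by simp
  finally show ?thesis .
qed

text \<open>If every prime up to \<open>N\<close> made more than half of \<open>A\<close> collide, the weighted
  number of collisions would be at least \<open>chebyshev_theta N * card A / 2\<close>, more than the
  previous lemma allows.\<close>

lemma exists_halving_prime:
  fixes R :: real
  assumes "finite A" and "A \<noteq> {}"
    and "\<And>a b. a \<in> A \<Longrightarrow> b \<in> A \<Longrightarrow> real_of_int \<bar>a - b\<bar> \<le> R" and "R > 1"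
    and "2 * real (card A) * ln R \<le> chebyshev_theta N"
  shows "\<exists>p. prime p \<and> p \<le> N \<and> 2 * card (colliding A p) \<le> card A"
proof (rule ccontr)
  assume "\<not> ?thesis"
  then have bad: "card A \<le> 2 * card (colliding A p)" if "prime p" "p \<le> N" for p
    using that nat_le_linear by blast
  let ?t = "real (card A)"
  have t: "?t > 0"
    using assms(1,2) by (simp add: card_gt_0_iff)
  have "?t * ?t * ln R \<le> chebyshev_theta N * (?t / 2)"
    using mult_right_mono[OF assms(5), of "?t / 2"] by (simp add: mult_ac)
  also have "\<dots> = (\<Sum>p | prime p \<and> p \<le> N. ln (real p) * (?t / 2))"
    by (simp add: chebyshev_theta_def sum_distrib_right)
  also have "\<dots> \<le> (\<Sum>p | prime p \<and> p \<le> N. ln (real p) * real (card (colliding A p)))"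
  proof (intro sum_mono mult_left_mono)
    fix p assume "p \<in> {p. prime p \<and> p \<le> N}"
    then show "?t / 2 \<le> real (card (colliding A p))" and "0 \<le> ln (real p)"
      using bad[of p] prime_gt_0_nat[of p] by auto
  qed
  also have "\<dots> \<le> ?t * real (card A - 1) * ln R"
    by (rule sum_ln_card_colliding_le) (use assms in auto)
  finally have "?t \<le> real (card A - 1)"
    using t assms(4) by (simp add: mult.assoc)
  then show False
    using t by linarith
qed

text \<open>Let \<open>t = card A\<close> and \<open>m = log 2 R\<close>, so \<open>m \<ge> 8\<close>. The
  previous lemma needs \<open>2 * t * ln R \<le> 25 / 18 * t * m\<close> from Chebyshev's function,
  while \<open>ln (2 * m) \<ge> ln 16 \<ge> 8 / 3\<close> makes the permitted size at least
  \<open>32 / 3 * t * m\<close>, of which the fraction \<open>4 / 25\<close> suffices. The bound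
  \<open>R \<ge> 256\<close> thus serves both to enlarge that logarithm and to reach the range where
  the Chebyshev bound applies.\<close>

lemma exists_small_halving_prime:
  fixes R :: real
  assumes "finite A" and "card A \<ge> 2"
    and "\<And>a b. a \<in> A \<Longrightarrow> b \<in> A \<Longrightarrow> real_of_int \<bar>a - b\<bar> \<le> R" and "R \<ge> 256"
  shows "\<exists>p. prime p \<and> real p \<le> 4 * real (card A) * log 2 R * ln (2 * log 2 R)
    \<and> 2 * card (colliding A p) \<le> card A"
proof -
  define t where "t = real (card A)"
  define m where "m = log 2 R"
  define X where "X = 4 * t * m * ln (2 * m)"
  define N where "N = nat \<lfloor>X\<rfloor>"
  have ln2: "ln 2 \<ge> (2/3 :: real)" "ln 2 \<le> (25/36 :: real)"
    using ln2_ge_two_thirds ln2_le_25_over_36 by auto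
  have t: "t \<ge> 2"
    unfolding t_def using assms(2) by simp
  have "log 2 (2 ^ 8) \<le> m"
    unfolding m_def using assms(4) by (subst log_le_cancel_iff) auto
  then have m: "m \<ge> 8"
    by (simp only: log_pow_cancel)
  have "ln (2 ^ 4) \<le> ln (2 * m)"
    using m by (subst ln_le_cancel_iff) auto
  then have lnm: "ln (2 * m) \<ge> 8 / 3"
    using ln2 ln_realpow[of 2 4] by simp
  have tm: "t * m \<ge> 16"
    using mult_mono[of 2 t 8 m] t m by simp
  have "t * m * ln (2 * m) \<ge> t * m * (8 / 3)"
    using lnm t m by (intro mult_left_mono) auto
  then have X: "X \<ge> 32 / 3 * (t * m)"
    unfolding X_def by (simp add: mult_ac)
  have N: "real N \<le> X" "X \<le> real N + 1"
    unfolding N_def using X tm by linarith+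
  have "N \<ge> 144"
    using N X tm by linarith
  then have "chebyshev_theta N \<ge> 4 / 25 * real N"
    by (rule chebyshev_theta_ge_fraction)
  moreover have "2 * t * ln R \<le> 25 / 18 * (t * m)"
  proof -
    have "ln R = m * ln 2"
      unfolding m_def by (simp add: log_def)
    then show ?thesis
      using mult_left_mono[OF ln2(2), of "2 * (t * m)"] tm by (simp add: mult_ac)
  qed
  ultimately have "2 * t * ln R \<le> chebyshev_theta N"
    using N X tm by linarith
  then obtain p where "prime p" "p \<le> N" "2 * card (colliding A p) \<le> card A"
    using exists_halving_prime[of A R N] assms unfolding t_def by fastforce
  then show ?thesis
    using N unfolding X_def t_def m_def by (intro exI[of _ p]) auto
qed

section \<open>Separating schemes\<close>

text \<open>The combinatorial content of successive reconstruction: when lattice \<open>\<nu> a\<close> is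
  reached, the numbers \<open>b\<close> of smaller index have been subtracted already, so \<open>a\<close>
  has to be distinguished modulo \<open>P (\<nu> a)\<close> only from those with
  \<open>\<nu> a \<le> \<nu> b\<close>.\<close>

definition separating_scheme :: "int set \<Rightarrow> nat \<Rightarrow> (nat \<Rightarrow> nat) \<Rightarrow> (int \<Rightarrow> nat) \<Rightarrow> bool"
  where "separating_scheme A L P \<nu> \<longleftrightarrow>
    (\<forall>l<L. prime (P l)) \<and> \<nu> \<in> A \<rightarrow> {..<L} \<and>
    (\<forall>a\<in>A. \<forall>b\<in>A. \<nu> a \<le> \<nu> b \<and> int (P (\<nu> a)) dvd a - b \<longrightarrow> a = b)"

lemma separating_scheme_single:
  assumes "prime p" and "\<And>a b. a \<in> A \<Longrightarrow> b \<in> A \<Longrightarrow> \<bar>a - b\<bar> < int p"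
  shows "separating_scheme A 1 (\<lambda>_. p) (\<lambda>_. 0)"
proof -
  have "a = b" if "a \<in> A" "b \<in> A" "int p dvd a - b" for a b
    using assms(2)[OF that(1,2)] dvd_imp_le_int[OF _ that(3)] by fastforce
  then show ?thesis
    using assms(1) by (auto simp: separating_scheme_def)
qed

text \<open>One step of the construction: the numbers alone in their residue class modulo
  \<open>p\<close> are assigned to a new first lattice, and the scheme for the colliding ones is shifted
  by one index.\<close>

lemma separating_scheme_extend:
  assumes "prime p" and "separating_scheme (colliding A p) L P \<nu>"
  shows "separating_scheme A (Suc L) (case_nat p P)
    (\<lambda>a. if a \<in> colliding A p then Suc (\<nu> a) else 0)"
  unfolding separating_scheme_def
proof (intro conjI ballI allI impI)
  fix l assume "l < Suc L"
  then show "prime (case_nat p P l)"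
    using assms by (auto simp: separating_scheme_def split: nat.split)
next
  show "(\<lambda>a. if a \<in> colliding A p then Suc (\<nu> a) else 0) \<in> A \<rightarrow> {..<Suc L}"
    using assms(2) by (auto simp: separating_scheme_def)
next
  fix a b
  let ?\<nu> = "\<lambda>a. if a \<in> colliding A p then Suc (\<nu> a) else 0"
  assume ab: "a \<in> A" "b \<in> A"
    and *: "?\<nu> a \<le> ?\<nu> b \<and> int (case_nat p P (?\<nu> a)) dvd a - b"
  show "a = b"
  proof (cases "a \<in> colliding A p")
    case True
    then have "b \<in> colliding A p" "\<nu> a \<le> \<nu> b" "int (P (\<nu> a)) dvd a - b"
      using * by (auto split: if_splits)
    then show ?thesis
      using True assms(2) unfolding separating_scheme_def by blast
  next
    case False
    then have "int p dvd a - b"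
      using * by simp
    then show ?thesis
      using False ab by (auto simp: colliding_def)
  qed
qed

text \<open>Each step at least halves the set, so \<open>log 2 (card A) + 1\<close> steps suffice. With
  \<open>K = log 2 R * ln (2 * log 2 R)\<close>, the prime costs at most
  \<open>4 * card A * K\<close> and the remaining half costs at most, by induction,
  \<open>8 * (card A / 2) * K\<close>, which add up to \<open>8 * card A * K\<close>.\<close>

lemma exists_separating_scheme_halving:
  fixes R :: real
  assumes "finite A" and "A \<noteq> {}"
    and "\<And>a b. a \<in> A \<Longrightarrow> b \<in> A \<Longrightarrow> real_of_int \<bar>a - b\<bar> \<le> R" and "R \<ge> 256"
  shows "\<exists>L P \<nu>. separating_scheme A L P \<nu> \<and> real L \<le> log 2 (real (card A)) + 1
    \<and> real (\<Sum>l<L. P l) \<le> 8 * real (card A) * log 2 R * ln (2 * log 2 R)"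
  using assms(1-3)
proof (induction "card A" arbitrary: A rule: less_induct)
  case less
  define K where "K = log 2 R * ln (2 * log 2 R)"
  have "log 2 (2 ^ 8) \<le> log 2 R"
    using assms(4) by (subst log_le_cancel_iff) auto
  then have m: "log 2 R \<ge> 8"
    by (simp only: log_pow_cancel)
  have "ln (2 ^ 4) \<le> ln (2 * log 2 R)"
    using m by (subst ln_le_cancel_iff) auto
  then have "ln (2 * log 2 R) \<ge> 1"
    using ln2_ge_two_thirds ln_realpow[of 2 4] by simp
  then have K: "K \<ge> 8"
    unfolding K_def using mult_mono[of 8 "log 2 R" 1 "ln (2 * log 2 R)"] m by simp
  show ?case
  proof (cases "card A = 1")
    case True
    then have "separating_scheme A 1 (\<lambda>_. 2) (\<lambda>_. 0)"
      by (intro separating_scheme_single) (auto simp: card_1_singleton_iff)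
    then show ?thesis
      using True K by (intro exI[of _ 1] exI[of _ "\<lambda>_. 2"] exI[of _ "\<lambda>_. 0"])
        (simp add: K_def mult.assoc)
  next
    case False
    then have card: "card A \<ge> 2"
      using less.prems card_gt_0_iff[of A] by linarith
    then obtain p where p: "prime p" "real p \<le> 4 * real (card A) * K"
        and half: "2 * card (colliding A p) \<le> card A"
      using exists_small_halving_prime[of A R] less.prems assms(4) by (auto simp: K_def mult.assoc)
    let ?B = "colliding A p"
    have sub: "?B \<subseteq> A" by (auto simp: colliding_def)
    have "\<exists>L P \<nu>. separating_scheme ?B L P \<nu> \<and> real L \<le> log 2 (real (card A))
      \<and> real (\<Sum>l<L. P l) \<le> 8 * real (card ?B) * K"
    proof (cases "?B = {}")
      case True
      then have "separating_scheme ?B 0 P \<nu>" for P \<nu>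
        by (simp add: separating_scheme_def)
      then show ?thesis
        using True card by (intro exI[of _ 0] exI) auto
    next
      case False
      have fin: "finite ?B"
        using sub less.prems(1) finite_subset by blast
      then have B: "card ?B > 0"
        using False by (simp add: card_gt_0_iff)
      then have "card ?B < card A"
        using half by linarith
      then obtain L P \<nu> where "separating_scheme ?B L P \<nu>" and L: "real L \<le> log 2 (real (card ?B)) + 1"
        and "real (\<Sum>l<L. P l) \<le> 8 * real (card ?B) * K"
        using less.hyps[of ?B] fin False less.prems(3) sub
        by (auto simp: K_def mult.assoc subset_iff)
      moreover have "log 2 (real (card ?B)) + 1 = log 2 (2 * real (card ?B))"
        using B by (simp add: log_mult)
      moreover have "\<dots> \<le> log 2 (real (card A))"
        using half B by (subst log_le_cancel_iff) auto
      ultimately show ?thesis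
        by force
    qed
    then obtain L P \<nu> where scheme: "separating_scheme ?B L P \<nu>" and L: "real L \<le> log 2 (real (card A))"
      and sum: "real (\<Sum>l<L. P l) \<le> 8 * real (card ?B) * K"
      by blast
    have "real (\<Sum>l<Suc L. case_nat p P l) = real p + real (\<Sum>l<L. P l)"
      by (simp add: sum.lessThan_Suc_shift del: sum.lessThan_Suc)
    also have "\<dots> \<le> 4 * real (card A) * K + 4 * real (card A) * K"
    proof -
      have "8 * real (card ?B) * K \<le> 4 * real (card A) * K"
        using half K by (intro mult_right_mono) auto
      then show ?thesis
        using p(2) sum by linarith
    qed
    finally show ?thesis
      using separating_scheme_extend[OF p(1) scheme] L
      by (intro exI[of _ "Suc L"] exI[of _ "case_nat p P"] exI conjI) (auto simp: K_def mult.assoc)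
  qed
qed

text \<open>For differences too small for the Chebyshev bound one prime exceeding all of them is
  cheap enough. The primes 2, 23, 127 and 257 cover four ranges of \<open>m\<close>, each chosen
  below the value of the bound at the left end of a range; the bound itself is estimated by
  \<open>ln 2 \<ge> 2 / 3\<close>.\<close>

lemma exists_prime_single_lattice:
  fixes m :: nat
  assumes "m \<ge> 2" and "m \<le> 257"
  shows "\<exists>p. prime p \<and> m \<le> p \<and> real p \<le> 16 * log 2 (real m) * ln (2 * log 2 (real m))"
proof -
  have ln2: "ln 2 \<ge> (2/3 :: real)"
    using ln2_ge_two_thirds .
  have bound: "16 * a * (b * ln 2) \<le> 16 * log 2 (real m) * ln (2 * log 2 (real m))"
    if "a \<le> log 2 (real m)" "2 powr b \<le> 2 * a" "b \<ge> 0" "a > 0" for a b :: real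
  proof -
    have "b * ln 2 = ln (2 powr b)"
      by simp
    also have "\<dots> \<le> ln (2 * log 2 (real m))"
      using that by (subst ln_le_cancel_iff) auto
    finally show ?thesis
      using that ln2 by (intro mult_mono) auto
  qed
  consider "m = 2" | "3 \<le> m \<and> m \<le> 23" | "24 \<le> m \<and> m \<le> 127" | "128 \<le> m"
    using assms(1) by linarith
  then show ?thesis
  proof cases
    case 1
    then show ?thesis
      using ln2 by (intro exI[of _ 2]) auto
  next
    case 2
    \<comment> \<open>\<open>log 2 3 \<ge> 3 / 2\<close> because \<open>3 ^ 2 \<ge> 2 ^ 3\<close>; likewise for \<open>3 \<ge> 2 powr (3 / 2)\<close>.\<close>
    have "3 = log 2 (2 ^ 3)"
      by (simp only: log_pow_cancel)
    also have "\<dots> \<le> log 2 (real m ^ 2)"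
      using 2 power_mono[of 3 "real m" 2] by (subst log_le_cancel_iff) auto
    also have "\<dots> = 2 * log 2 (real m)"
      using 2 by (simp add: log_nat_power)
    finally have "3 / 2 \<le> log 2 (real m)" by simp
    moreover have "(2::real) powr (3/2) \<le> 2 * (3/2)"
    proof (rule power2_le_imp_le)
      show "((2::real) powr (3/2))\<^sup>2 \<le> (2 * (3/2))\<^sup>2"
        by (simp add: powr_power)
    qed simp
    ultimately have "16 * (3/2) * (3/2 * ln 2) \<le> 16 * log 2 (real m) * ln (2 * log 2 (real m))"
      by (intro bound) auto
    moreover have "prime (23::nat)" by simp
    ultimately show ?thesis
      using ln2 2 by (intro exI[of _ 23]) auto
  next
    case 3
    have "4 = log 2 (2 ^ 4)"
      by (simp only: log_pow_cancel)
    also have "\<dots> \<le> log 2 (real m)"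
      using 3 by (subst log_le_cancel_iff) auto
    finally have "16 * 4 * (3 * ln 2) \<le> 16 * log 2 (real m) * ln (2 * log 2 (real m))"
      by (intro bound) auto
    moreover have "prime (127::nat)" by simp
    ultimately show ?thesis
      using ln2 3 by (intro exI[of _ 127]) auto
  next
    case 4
    have "7 = log 2 (2 ^ 7)"
      by (simp only: log_pow_cancel)
    also have "\<dots> \<le> log 2 (real m)"
      using 4 by (subst log_le_cancel_iff) auto
    finally have "7 \<le> log 2 (real m)" .
    moreover have "(2::real) powr (7/2) \<le> 2 * 7"
    proof (rule power2_le_imp_le)
      show "((2::real) powr (7/2))\<^sup>2 \<le> (2 * 7)\<^sup>2"
        by (simp add: powr_power)
    qed simp
    ultimately have "16 * 7 * (7/2 * ln 2) \<le> 16 * log 2 (real m) * ln (2 * log 2 (real m))"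
      by (intro bound) auto
    moreover have "prime (257::nat)" by simp
    ultimately show ?thesis
      using ln2 4 assms(2) by (intro exI[of _ 257]) auto
  qed
qed

text \<open>The factor 16 of the single-prime bound is \<open>8 * card A\<close> for the smallest
  nontrivial cardinality 2. For a singleton the logarithms vanish or are undefined
  (\<open>Mt = 1\<close>), which is why that case carries the bound 2.\<close>

lemma exists_separating_scheme:
  fixes Mt :: int
  assumes "finite A" and "A \<noteq> {}" and "Mt = Max A - Min A + 1"
  shows "\<exists>L P \<nu>. separating_scheme A L P \<nu> \<and> real L \<le> log 2 (real (card A)) + 1
    \<and> real (\<Sum>l<L. P l) \<le> (if card A = 1 then 2
        else 8 * real (card A) * log 2 (real_of_int Mt) * ln (2 * log 2 (real_of_int Mt)))"
proof -
  have diff: "\<bar>a - b\<bar> < Mt" if "a \<in> A" "b \<in> A" for a b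
    using Max_ge[OF assms(1) that(1)] Max_ge[OF assms(1) that(2)]
      Min_le[OF assms(1) that(1)] Min_le[OF assms(1) that(2)] unfolding assms(3) by linarith
  consider "card A = 1" | "card A \<ge> 2" "Mt \<le> 257" | "card A \<noteq> 1" "Mt \<ge> 256"
    using assms(1,2) card_gt_0_iff[of A] by linarith
  then show ?thesis
  proof cases
    case 1
    then have "separating_scheme A 1 (\<lambda>_. 2) (\<lambda>_. 0)"
      by (intro separating_scheme_single) (auto simp: card_1_singleton_iff)
    then show ?thesis
      using 1 by (intro exI[of _ 1] exI[of _ "\<lambda>_. 2"] exI[of _ "\<lambda>_. 0"]) simp
  next
    case 2
    then obtain a b where "a \<in> A" "b \<in> A" "a \<noteq> b"
      using card_le_Suc0_iff_eq[OF assms(1)] by fastforce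
    then have "Mt \<ge> 2"
      using diff[of a b] by linarith
    define K where "K = log 2 (real_of_int Mt) * ln (2 * log 2 (real_of_int Mt))"
    have "nat Mt \<ge> 2" "nat Mt \<le> 257"
      using 2(2) \<open>Mt \<ge> 2\<close> by auto
    from exists_prime_single_lattice[OF this]
    obtain p where p: "prime p" "nat Mt \<le> p" "real p \<le> 16 * K"
      using \<open>Mt \<ge> 2\<close> by (auto simp: K_def mult.assoc)
    then have "\<bar>a - b\<bar> < int p" if "a \<in> A" "b \<in> A" for a b
      using diff[OF that] by linarith
    then have "separating_scheme A 1 (\<lambda>_. p) (\<lambda>_. 0)"
      by (rule separating_scheme_single[OF p(1)])
    moreover have "real p \<le> 8 * real (card A) * K"
    proof -
      have "K \<ge> 0"
        using p(3) by linarith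
      then have "16 * K \<le> 8 * real (card A) * K"
        using 2(1) by (intro mult_right_mono) auto
      then show ?thesis
        using p(3) by linarith
    qed
    ultimately show ?thesis
      using 2(1) by (intro exI[of _ 1] exI[of _ "\<lambda>_. p"] exI[of _ "\<lambda>_. 0"])
        (simp add: K_def mult.assoc)
  next
    case 3
    have "real_of_int \<bar>a - b\<bar> \<le> real_of_int Mt" if "a \<in> A" "b \<in> A" for a b
      using diff[OF that] by linarith
    then show ?thesis
      using exists_separating_scheme_halving[OF assms(1,2), of "real_of_int Mt"] 3 by simp
  qed
qed

section \<open>Fourier coefficients on rank-1 lattices\<close>

text \<open>Reducing the coordinates modulo \<open>P\<close> changes the phase by an integer multiple of
  the period, so on the lattice a monomial depends on its frequency only through one integer,
  taken modulo \<open>P\<close>.\<close>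

lemma trig_monomial_lattice_point:
  assumes "P > 0"
  shows "trig_monomial h (lattice_point z P j)
    = exp (2 * of_real pi * \<i> * of_nat j * of_int (freq_dot h z) / of_nat P)"
proof -
  define n where "n = (\<Sum>i\<in>UNIV. h $ i * ((int j * z $ i) div int P))"
  have "(\<chi> i. real_of_int (h $ i)) \<bullet> lattice_point z P j
      = (\<Sum>i\<in>UNIV. real_of_int (h $ i) * (real_of_int ((int j * z $ i) mod int P) / real P))"
    by (simp add: inner_vec_def lattice_point_def)
  also have "\<dots> = (\<Sum>i\<in>UNIV. real j * real_of_int (h $ i * z $ i) / real P
      - real_of_int (h $ i * ((int j * z $ i) div int P)))"
  proof (intro sum.cong refl)
    fix i
    have "real_of_int ((int j * z $ i) mod int P)
        = real j * real_of_int (z $ i) - real P * real_of_int ((int j * z $ i) div int P)"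
      by (simp flip: minus_mult_div_eq_mod)
    then show "real_of_int (h $ i) * (real_of_int ((int j * z $ i) mod int P) / real P)
        = real j * real_of_int (h $ i * z $ i) / real P
          - real_of_int (h $ i * ((int j * z $ i) div int P))"
      using assms by (simp add: right_diff_distrib diff_divide_distrib mult_ac)
  qed
  also have "\<dots> = real j * real_of_int (freq_dot h z) / real P - real_of_int n"
    by (simp add: sum_subtractf n_def freq_dot_def sum_distrib_left sum_divide_distrib)
  finally have inner: "(\<chi> i. real_of_int (h $ i)) \<bullet> lattice_point z P j
      = real j * real_of_int (freq_dot h z) / real P - real_of_int n" .
  have "trig_monomial h (lattice_point z P j)
      = exp (2 * of_real pi * \<i> * of_nat j * of_int (freq_dot h z) / of_nat P
          - of_int (2 * n) * of_real pi * \<i>)"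
    unfolding trig_monomial_def inner by (simp add: algebra_simps)
  also have "\<dots> = exp (2 * of_real pi * \<i> * of_nat j * of_int (freq_dot h z) / of_nat P)"
    using exp_integer_2pi[of "of_int n"] by (simp add: exp_diff mult_ac)
  finally show ?thesis .
qed

lemma sum_lattice_characters:
  fixes m :: int
  assumes "P > 0"
  shows "(\<Sum>j<P. exp (2 * of_real pi * \<i> * of_nat j * of_int m / of_nat P))
    = (if int P dvd m then of_nat P else (0::complex))"
proof -
  define q where "q = exp (2 * of_real pi * \<i> * of_int m / of_nat P :: complex)"
  have power: "exp (2 * of_real pi * \<i> * of_nat j * of_int m / of_nat P) = q ^ j" for j
    unfolding q_def by (simp add: mult_ac flip: exp_of_nat_mult)
  have "q ^ P = exp (2 * of_int m * of_real pi * \<i>)"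
    unfolding power[symmetric] using assms by (simp add: mult_ac)
  also have "\<dots> = 1"
    using exp_integer_2pi[of "of_int m"] by (simp add: mult_ac)
  finally have "q ^ P = 1" .
  have q1: "q = 1 \<longleftrightarrow> int P dvd m"
  proof
    assume "q = 1"
    then obtain n :: int where "2 * pi * m / P = of_int (2 * n) * pi"
      unfolding q_def by (auto simp: exp_eq_1)
    then have "real_of_int m = real_of_int (n * int P)"
      using assms by (simp add: field_simps)
    then have "m = n * int P"
      by (simp only: of_int_eq_iff)
    then show "int P dvd m" by simp
  next
    assume "int P dvd m"
    then obtain n where "m = int P * n" ..
    then have "q = exp (2 * of_int n * of_real pi * \<i>)"
      unfolding q_def using assms by (simp add: mult_ac)
    then show "q = 1"
      using exp_integer_2pi[of "of_int n"] by simp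
  qed
  show ?thesis
    unfolding power using q1 \<open>q ^ P = 1\<close> by (cases "q = 1") (auto simp: sum_gp_strict)
qed

text \<open>Aliasing: the lattice rule returns the sum of all coefficients whose frequencies are
  congruent to that of \<open>k\<close>, which here is a single one.\<close>

lemma fourier_coefficient_from_lattice:
  fixes z :: "int ^ 'd"
  assumes "finite J" and "k \<in> J" and "P > 0"
    and "\<And>h. h \<in> J \<Longrightarrow> int P dvd freq_dot h z - freq_dot k z \<Longrightarrow> h = k"
  shows "(\<Sum>j<P. (\<Sum>h\<in>J. c h * trig_monomial h (lattice_point z P j))
    * exp (- 2 * of_real pi * \<i> * of_nat j * of_int (freq_dot k z) / of_nat P)) = of_nat P * c k"
    (is "(\<Sum>j<P. (\<Sum>h\<in>J. c h * ?e h j) * ?d j) = _")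
proof -
  have prod: "?e h j * ?d j
      = exp (2 * of_real pi * \<i> * of_nat j * of_int (freq_dot h z - freq_dot k z) / of_nat P)" for h j
    unfolding trig_monomial_lattice_point[OF assms(3)] exp_add[symmetric]
    by (simp add: algebra_simps diff_divide_distrib)
  have "(\<Sum>j<P. (\<Sum>h\<in>J. c h * ?e h j) * ?d j) = (\<Sum>h\<in>J. c h * (\<Sum>j<P. ?e h j * ?d j))"
    unfolding sum_distrib_left sum_distrib_right mult.assoc by (rule sum.swap)
  also have "\<dots> = (\<Sum>h\<in>J. if h = k then of_nat P * c k else 0)"
    unfolding prod sum_lattice_characters[OF assms(3)] using assms(4) by (intro sum.cong) auto
  also have "\<dots> = of_nat P * c k"
    using assms(1,2) by simp
  finally show ?thesis .
qed

lemma residual_reconstruction: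
  fixes z :: "int ^ 'd"
  assumes "finite I" and "inj_on (\<lambda>k. freq_dot k z) I"
    and scheme: "separating_scheme ((\<lambda>k. freq_dot k z) ` I) L P \<nu>'"
    and \<nu>: "\<nu> = (\<lambda>k. \<nu>' (freq_dot k z))"
    and f: "\<And>x. f x = (\<Sum>k\<in>I. c k * trig_monomial k x)" and k: "k \<in> I"
  shows "c k = 1 / of_nat (P (\<nu> k)) *
    (\<Sum>j<P (\<nu> k). residual I \<nu> c f (\<nu> k) (lattice_point z (P (\<nu> k)) j) *
      exp (- 2 * of_real pi * \<i> * of_nat j * of_int (freq_dot k z) / of_nat (P (\<nu> k))))"
proof -
  let ?J = "{h\<in>I. \<nu> k \<le> \<nu> h}"
  have "\<nu> k < L"
    using scheme k unfolding separating_scheme_def \<nu> by auto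
  then have P: "P (\<nu> k) > 0"
    using scheme by (auto simp: separating_scheme_def prime_gt_0_nat)
  have residual: "residual I \<nu> c f (\<nu> k) x = (\<Sum>h\<in>?J. c h * trig_monomial h x)" for x
  proof -
    have "f x = (\<Sum>h\<in>{h\<in>I. \<nu> h < \<nu> k} \<union> ?J. c h * trig_monomial h x)"
      unfolding f by (intro sum.cong) auto
    also have "\<dots> = (\<Sum>h\<in>{h\<in>I. \<nu> h < \<nu> k}. c h * trig_monomial h x)
        + (\<Sum>h\<in>?J. c h * trig_monomial h x)"
      using assms(1) by (intro sum.union_disjoint) auto
    finally show ?thesis
      by (simp add: residual_def)
  qed
  have "h = k" if "h \<in> ?J" "int (P (\<nu> k)) dvd freq_dot h z - freq_dot k z" for h
  proof -
    have "int (P (\<nu> k)) dvd freq_dot k z - freq_dot h z"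
      using that(2) by (simp add: dvd_diff_commute)
    then have "freq_dot k z = freq_dot h z"
      using scheme that(1) k unfolding separating_scheme_def \<nu> by auto
    then show ?thesis
      using assms(2) that(1) k by (auto dest: inj_onD)
  qed
  then show ?thesis
    unfolding residual using P k assms(1) by (subst fourier_coefficient_from_lattice) auto
qed

text \<open>The reconstruction formula for \<open>f - g\<close> determines a coefficient from samples,
  which vanish, and from coefficients of smaller index. So all of them vanish by induction on the
  index.\<close>

lemma trig_polys_eq_if_eq_on_lattices:
  fixes z :: "int ^ 'd"
  assumes "finite I" and "inj_on (\<lambda>k. freq_dot k z) I"
    and scheme: "separating_scheme ((\<lambda>k. freq_dot k z) ` I) L P \<nu>'"
    and f: "f \<in> trig_polys I" and g: "g \<in> trig_polys I"
    and eq: "\<And>l x. l < L \<Longrightarrow> x \<in> rank1_lattice z (P l) \<Longrightarrow> f x = g x"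
  shows "f = g"
proof -
  define \<nu> where "\<nu> = (\<lambda>k. \<nu>' (freq_dot k z))"
  obtain a b where a: "f = (\<lambda>x. \<Sum>k\<in>I. a k * trig_monomial k x)"
    and b: "g = (\<lambda>x. \<Sum>k\<in>I. b k * trig_monomial k x)"
    using f g by (auto simp: trig_polys_def)
  define c where "c k = a k - b k" for k
  have diff: "f x - g x = (\<Sum>k\<in>I. c k * trig_monomial k x)" for x
    by (simp add: a b c_def left_diff_distrib sum_subtractf)
  have "c k = 0" if "k \<in> I" for k
    using that
  proof (induction "\<nu> k" arbitrary: k rule: less_induct)
    case less
    have "\<nu> k < L"
      using scheme less.prems unfolding separating_scheme_def \<nu>_def by auto
    then have "residual I \<nu> c (\<lambda>x. f x - g x) (\<nu> k) (lattice_point z (P (\<nu> k)) j) = 0"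
      if "j < P (\<nu> k)" for j
      using that less.hyps eq by (simp add: residual_def rank1_lattice_def)
    then show ?case
      using residual_reconstruction[OF assms(1,2) scheme \<nu>_def diff less.prems] by simp
  qed
  then have "f x - g x = 0" for x
    unfolding diff by simp
  then show ?thesis
    by (intro ext) simp
qed

theorem theorem2p8:
  fixes I :: "(int ^ 'd) set" and z :: "int ^ 'd" and M s :: nat and Mt :: int
  assumes "CARD('d) \<ge> 2"
    and "finite I" and "card I = s" and "s \<ge> 1"
    and "reconstructing_lattice z M I"
    and "Mt = Max ((\<lambda>k. freq_dot k z) ` I) - Min ((\<lambda>k. freq_dot k z) ` I) + 1"
  shows "\<exists>(L :: nat) (P :: nat \<Rightarrow> nat) (\<nu> :: int ^ 'd \<Rightarrow> nat).
    (\<forall>l<L. prime (P l)) \<and>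
    real L \<le> log 2 (real s) + 1 \<and>
    real (\<Sum>l<L. P l) \<le>
      (if s = 1 then 2
       else 8 * real s * log 2 (real_of_int Mt) * ln (2 * log 2 (real_of_int Mt))) \<and>
    \<nu> \<in> I \<rightarrow> {..<L} \<and>
    (\<forall>f \<in> trig_polys I. \<forall>c :: int ^ 'd \<Rightarrow> complex.
      (\<forall>x. f x = (\<Sum>k\<in>I. c k * trig_monomial k x)) \<longrightarrow>
      (\<forall>k\<in>I. c k = 1 / of_nat (P (\<nu> k)) *
        (\<Sum>j<P (\<nu> k). residual I \<nu> c f (\<nu> k) (lattice_point z (P (\<nu> k)) j) *
          exp (- 2 * of_real pi * \<i> * of_nat j * of_int (freq_dot k z) / of_nat (P (\<nu> k)))))) \<and>
    (\<forall>f \<in> trig_polys I. \<forall>g \<in> trig_polys I.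
      (\<forall>l<L. \<forall>x \<in> rank1_lattice z (P l). f x = g x) \<longrightarrow> f = g)"
proof -
  let ?a = "\<lambda>k. freq_dot k z"
  have inj: "inj_on ?a I"
    using assms(5) by (auto simp: reconstructing_lattice_def inj_on_def)
  then have card: "card (?a ` I) = s"
    using assms(3) by (simp add: card_image)
  have "?a ` I \<noteq> {}"
    using assms(3,4) by auto
  then obtain L P \<nu>' where scheme: "separating_scheme (?a ` I) L P \<nu>'"
    and L: "real L \<le> log 2 (real s) + 1"
    and sum: "real (\<Sum>l<L. P l) \<le> (if s = 1 then 2
        else 8 * real s * log 2 (real_of_int Mt) * ln (2 * log 2 (real_of_int Mt)))"
    using exists_separating_scheme[OF _ _ assms(6)] assms(2) unfolding card by blast
  define \<nu> where "\<nu> = (\<lambda>k. \<nu>' (?a k))"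
  show ?thesis
  proof (intro exI[of _ L] exI[of _ P] exI[of _ \<nu>] conjI)
    show "\<forall>l<L. prime (P l)"
      using scheme by (simp add: separating_scheme_def)
    show "\<nu> \<in> I \<rightarrow> {..<L}"
      using scheme by (auto simp: separating_scheme_def \<nu>_def)
    show "\<forall>f \<in> trig_polys I. \<forall>g \<in> trig_polys I.
        (\<forall>l<L. \<forall>x \<in> rank1_lattice z (P l). f x = g x) \<longrightarrow> f = g"
      using trig_polys_eq_if_eq_on_lattices[OF assms(2) inj scheme] by blast
  qed (use L sum residual_reconstruction[OF assms(2) inj scheme \<nu>_def] in auto)
qed

end
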